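(* For $n \in \mathbb{N}$ let $$\mathcal{S}_n := \{S \subset \{1,2,\ldots,n\} : D(S) \text{ has only odd numbers or has only even numbers}\},$$ $$\mathcal{S}_{n,1} := \{S \subset \{1,2,\ldots,n\} : D(S) \text{ has only odd numbers}\},$$ $$\mathcal{S}_{n,2} := \{S \subset \{1,2,\ldots,n\} : D(S) \text{ has only even numbers}\}.$$ Then $\lim_{n\to\infty} \frac{|\mathcal{S}_{n,1}|}{|\mathcal{S}_n|} = 1$; that is, as $n \to \infty$, almost all sets in $\mathcal{S}_n$ have difference sets containing only odd numbers.
   Context: For a finite set $S = \{s_1 < s_2 < \cdots < s_k\}$ of natural numbers with $k \ge 2$, the difference set is $D(S) = \{s_2-s_1, s_3-s_2, \ldots, s_k-s_{k-1}\}$; for the empty set and one-element sets, $D(S) = \emptyset$, so these sets vacuously satisfy both the "only odd numbers" and the "only even numbers" conditions. *)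

theory Defs
  imports Complex_Main
begin

text \<open>
  For a finite set \<open>S = {s\<^sub>1 < ... < s\<^sub>k}\<close> the entry \<open>sorted_list_of_set S ! i\<close> is
  \<open>s\<close> with index \<open>i + 1\<close>. The subtraction on \<^typ>\<open>nat\<close> never truncates, as the
  list is increasing. For \<open>k \<le> 1\<close> there is no admissible index, so the result is empty.
\<close>

definition difference_set :: "nat set \<Rightarrow> nat set" where
  "difference_set S =
    (let s = sorted_list_of_set S in {s ! Suc i - s ! i | i. Suc i < length s})"

definition parity_sets :: "nat \<Rightarrow> nat set set" where
  "parity_sets n = {S. S \<subseteq> {1..n} \<and>
     ((\<forall>d \<in> difference_set S. odd d) \<or> (\<forall>d \<in> difference_set S. even d))}"

definition odd_diff_sets :: "nat \<Rightarrow> nat set set" where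
  "odd_diff_sets n = {S. S \<subseteq> {1..n} \<and> (\<forall>d \<in> difference_set S. odd d)}"

definition even_diff_sets :: "nat \<Rightarrow> nat set set" where
  "even_diff_sets n = {S. S \<subseteq> {1..n} \<and> (\<forall>d \<in> difference_set S. even d)}"

lemma difference_set_empty [simp]: "difference_set {} = {}"
  by (simp add: difference_set_def)

lemma difference_set_singleton [simp]: "difference_set {a} = {}"
  by (simp add: difference_set_def)

lemma difference_set_strict_sorted:
  assumes "sorted_wrt (<) xs"
  shows "difference_set (set xs) = {xs ! Suc i - xs ! i | i. Suc i < length xs}"
  using assms
  by (simp add: difference_set_def strict_sorted_iff sorted_list_of_set.idem_if_sorted_distinct)

lemma parity_sets_eq: "parity_sets n = odd_diff_sets n \<union> even_diff_sets n"
  by (auto simp: parity_sets_def odd_diff_sets_def even_diff_sets_def)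

lemma finite_parity_sets: "finite (parity_sets n)"
  by (rule finite_subset[of _ "Pow {1..n}"]) (auto simp: parity_sets_def)

end

theory Submission
  imports Defs
begin

text \<open>
  The sets with only even differences are the subsets of the even or of the odd numbers up to
  \<open>n\<close>, so there are only \<open>O(sqrt 2 ^ n)\<close> of them. The sets with only odd differences are those
  whose elements alternate in parity, and they grow like the Fibonacci numbers, whose growth rate,
  the golden ratio, exceeds \<open>sqrt 2\<close>. Hence the even sets are negligible.

  For the lower bound it is enough to count the alternating sets whose maximum has the parity of
  \<open>n\<close>: these satisfy the Fibonacci inequality \<open>f (n + 2) \<ge> f (n + 1) + f n\<close>
  (\<open>card_alternating_fibonacci\<close>), which gives \<open>f n \<ge> (3/2) ^ n\<close>. The rational rate \<open>3/2\<close> lies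
  between \<open>sqrt 2\<close> and the golden ratio, so the closed form of the Fibonacci numbers
  can be bypassed. Both the upper and the lower bound rest on the effect of a new
  maximum on the difference set (\<open>difference_set_insert_max\<close>).
\<close>

section \<open>Adding a new maximum\<close>

lemma difference_set_insert_max:
  assumes "finite T" "T \<noteq> {}" "\<And>x. x \<in> T \<Longrightarrow> x < m"
  shows "difference_set (insert m T) = insert (m - Max T) (difference_set T)"
proof -
  define xs where "xs = sorted_list_of_set T"
  have set_xs: "set xs = T" and sorted: "sorted_wrt (<) xs"
    using assms(1) by (simp_all add: xs_def)
  have "xs \<noteq> []" using set_xs assms(2) by auto
  then obtain ys z where "xs = ys @ [z]" by (metis rev_exhaust)
  then have "last xs = Max T"
    using sorted set_xs assms(1) by (intro Max_eqI[symmetric]) (auto simp: sorted_wrt_append)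
  then have last: "xs ! (length xs - 1) = Max T"
    using \<open>xs \<noteq> []\<close> by (simp add: last_conv_nth)
  have "sorted_wrt (<) (xs @ [m])"
    using sorted set_xs assms(3) by (simp add: sorted_wrt_append)
  then have "difference_set (insert m T) =
      {(xs @ [m]) ! Suc i - (xs @ [m]) ! i | i. Suc i < Suc (length xs)}"
    using difference_set_strict_sorted[of "xs @ [m]"] set_xs by simp
  also have "{i. Suc i < Suc (length xs)} = insert (length xs - 1) {i. Suc i < length xs}"
    using \<open>xs \<noteq> []\<close> by (cases xs) auto
  then have "{(xs @ [m]) ! Suc i - (xs @ [m]) ! i | i. Suc i < Suc (length xs)} =
      (\<lambda>i. (xs @ [m]) ! Suc i - (xs @ [m]) ! i) ` insert (length xs - 1) {i. Suc i < length xs}"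
    by blast
  also have "\<dots> = insert (m - Max T) ((\<lambda>i. xs ! Suc i - xs ! i) ` {i. Suc i < length xs})"
    using \<open>xs \<noteq> []\<close> last by (auto simp: nth_append image_def)
  also have "(\<lambda>i. xs ! Suc i - xs ! i) ` {i. Suc i < length xs} = difference_set T"
    using difference_set_strict_sorted[OF sorted] set_xs by auto
  finally show ?thesis .
qed

section \<open>Few sets have only even differences\<close>

lemma even_differences_imp_same_parity:
  assumes "finite S" "\<forall>d \<in> difference_set S. even d"
  shows "(\<forall>x\<in>S. even x) \<or> (\<forall>x\<in>S. odd x)"
  using assms
proof (induction S rule: finite_linorder_max_induct)
  case (insert m T)
  show ?case
  proof (cases "T = {}")
    case False
    have D: "difference_set (insert m T) = insert (m - Max T) (difference_set T)"
      using insert.hyps False by (intro difference_set_insert_max) auto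
    have "Max T \<in> T" "Max T < m" using insert.hyps False by auto
    moreover have "even (m - Max T)" using insert.prems D by simp
    ultimately have "even m = even (Max T)" by auto
    with insert.IH insert.prems D \<open>Max T \<in> T\<close> show ?thesis by auto
  qed auto
qed simp

text \<open>
  Halving is injective on either parity class, which embeds the even numbers as well as the odd
  numbers of \<open>{1..n}\<close> into \<open>{..n div 2}\<close>; the resulting constant 4 is immaterial.
\<close>

lemma card_even_diff_sets_le: "real (card (even_diff_sets n)) \<le> 4 * sqrt 2 ^ n"
proof -
  define E where "E = {x \<in> {1..n}. even x}"
  define O' where "O' = {x \<in> {1..n}. odd x}"
  have fin: "finite E" "finite O'" by (auto simp: E_def O'_def)
  have "even_diff_sets n \<subseteq> Pow E \<union> Pow O'"
  proof
    fix S assume S: "S \<in> even_diff_sets n"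
    then have "S \<subseteq> {1..n}" by (simp add: even_diff_sets_def)
    moreover from this have "finite S" by (rule finite_subset) simp
    ultimately show "S \<in> Pow E \<union> Pow O'"
      using S even_differences_imp_same_parity[of S]
      by (auto simp: even_diff_sets_def E_def O'_def)
  qed
  then have "card (even_diff_sets n) \<le> card (Pow E \<union> Pow O')"
    using fin by (intro card_mono) auto
  also have "\<dots> \<le> 2 ^ card E + 2 ^ card O'"
    using card_Un_le[of "Pow E" "Pow O'"] fin by (simp add: card_Pow)
  also have "\<dots> \<le> 2 ^ (n div 2 + 1) + 2 ^ (n div 2 + 1)"
  proof -
    have "inj_on (\<lambda>x. x div 2) E" "inj_on (\<lambda>x. x div 2) O'"
      by (auto simp: inj_on_def E_def O'_def elim!: evenE oddE)
    moreover have "(\<lambda>x. x div 2) ` E \<subseteq> {..n div 2}" "(\<lambda>x. x div 2) ` O' \<subseteq> {..n div 2}"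
      by (auto simp: E_def O'_def intro: div_le_mono)
    ultimately have "card E \<le> n div 2 + 1" "card O' \<le> n div 2 + 1"
      using card_inj_on_le[of "\<lambda>x. x div 2" _ "{..n div 2}"] by fastforce+
    then show ?thesis by (intro add_mono power_increasing) auto
  qed
  also have "\<dots> = 4 * 2 ^ (n div 2)" by simp
  finally have "real (card (even_diff_sets n)) \<le> real (4 * 2 ^ (n div 2))"
    by (rule of_nat_mono)
  also have "\<dots> = 4 * sqrt 2 ^ (2 * (n div 2))" by (simp add: power_mult)
  also have "\<dots> \<le> 4 * sqrt 2 ^ n" by (intro mult_left_mono power_increasing) auto
  finally show ?thesis .
qed

section \<open>Many sets have only odd differences\<close>

text \<open>
  Fixing the parity of the maximum relative to \<open>n\<close> makes extensions independent of the set at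
  hand: \<open>n + 1\<close> can always be appended. The empty set, whose \<open>Max\<close> is unspecified, is included
  because it admits every extension.
\<close>

definition alternating_sets :: "nat \<Rightarrow> nat set set" where
  "alternating_sets n = {S \<in> odd_diff_sets n. S \<noteq> {} \<longrightarrow> even (Max S + n)}"

lemma finite_odd_diff_sets: "finite (odd_diff_sets n)"
  by (rule finite_subset[OF _ finite_parity_sets[of n]]) (simp add: parity_sets_eq)

lemma finite_alternating_sets: "finite (alternating_sets n)"
  by (rule finite_subset[OF _ finite_odd_diff_sets[of n]]) (auto simp: alternating_sets_def)

lemma insert_Suc_alternating:
  assumes "S \<in> alternating_sets n"
  shows "insert (Suc n) S \<in> alternating_sets (Suc n)"
proof -
  have S: "S \<subseteq> {1..n}" "\<forall>d \<in> difference_set S. odd d" "S \<noteq> {} \<Longrightarrow> even (Max S + n)"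
    using assms by (auto simp: alternating_sets_def odd_diff_sets_def)
  have fin: "finite S" using S(1) by (rule finite_subset) simp
  have max: "Max (insert (Suc n) S) = Suc n"
    using S(1) fin by (intro Max_eqI) auto
  have "\<forall>d \<in> difference_set (insert (Suc n) S). odd d"
  proof (cases "S = {}")
    case False
    have D: "difference_set (insert (Suc n) S) = insert (Suc n - Max S) (difference_set S)"
      using S(1) fin False by (intro difference_set_insert_max) auto
    have "Max S \<in> S" using fin False by simp
    then have "Max S \<le> n" using S(1) by auto
    then have "odd (Suc n - Max S)" using S(3)[OF False] by simp
    then show ?thesis using D S(2) by simp
  qed simp
  moreover have "insert (Suc n) S \<subseteq> {1..Suc n}" using S(1) by auto
  ultimately show ?thesis by (simp add: alternating_sets_def odd_diff_sets_def max)
qed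

text \<open>
  An alternating set for \<open>n\<close> is one for \<open>n + 2\<close> as well, since the parity of the bound agrees,
  and an alternating set for \<open>n + 1\<close> becomes one after \<open>n + 2\<close> is appended. Membership of
  \<open>n + 2\<close> separates the two families.
\<close>

lemma card_alternating_fibonacci:
  "card (alternating_sets (Suc n)) + card (alternating_sets n)
     \<le> card (alternating_sets (Suc (Suc n)))"
proof -
  let ?A = "insert (Suc (Suc n)) ` alternating_sets (Suc n)" and ?B = "alternating_sets n"
  have new: "Suc (Suc n) \<notin> S" if "S \<in> alternating_sets (Suc n) \<or> S \<in> alternating_sets n" for S
    using that by (auto simp: alternating_sets_def odd_diff_sets_def)
  have "inj_on (insert (Suc (Suc n))) (alternating_sets (Suc n))"
    using new by (intro inj_onI) (metis Diff_insert_absorb insert_absorb insert_ident)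
  then have "card (alternating_sets (Suc n)) + card ?B = card ?A + card ?B"
    by (simp add: card_image)
  also have "\<dots> = card (?A \<union> ?B)"
    using new by (intro card_Un_disjoint[symmetric]) (auto simp: finite_alternating_sets)
  also have "\<dots> \<le> card (alternating_sets (Suc (Suc n)))"
  proof (rule card_mono[OF finite_alternating_sets])
    have "?B \<subseteq> alternating_sets (Suc (Suc n))"
      by (auto simp: alternating_sets_def odd_diff_sets_def)
    then show "?A \<union> ?B \<subseteq> alternating_sets (Suc (Suc n))"
      using insert_Suc_alternating by blast
  qed
  finally show ?thesis .
qed

text \<open>
  The rate \<open>3/2\<close> passes through the Fibonacci inequality because \<open>(3/2)\<^sup>2 \<le> 3/2 + 1\<close>.
\<close>

lemma card_alternating_sets_ge: "(3/2) ^ n \<le> real (card (alternating_sets n))"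
proof (induction n rule: induct_nat_012)
  case 0
  have "alternating_sets 0 = {{}}"
    by (auto simp: alternating_sets_def odd_diff_sets_def)
  then show ?case by simp
next
  case 1
  have "alternating_sets 1 = {{}, {1}}"
    by (auto simp: alternating_sets_def odd_diff_sets_def subset_singleton_iff)
  then show ?case by simp
next
  case (ge2 n)
  have "(3/2::real) ^ Suc (Suc n) \<le> (3/2) ^ Suc n + (3/2) ^ n" by simp
  also have "\<dots> \<le> real (card (alternating_sets (Suc n)) + card (alternating_sets n))"
    using ge2 by simp
  also have "\<dots> \<le> real (card (alternating_sets (Suc (Suc n))))"
    by (rule of_nat_mono[OF card_alternating_fibonacci])
  finally show ?case .
qed

lemma card_odd_diff_sets_ge: "(3/2) ^ n \<le> real (card (odd_diff_sets n))"
proof -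
  have "card (alternating_sets n) \<le> card (odd_diff_sets n)"
    by (rule card_mono[OF finite_odd_diff_sets]) (auto simp: alternating_sets_def)
  then show ?thesis using card_alternating_sets_ge[of n] by linarith
qed

section \<open>Almost all sets have only odd differences\<close>

theorem corollary1p9:
  shows "(\<lambda>n. real (card (odd_diff_sets n)) / real (card (parity_sets n))) \<longlonglongrightarrow> 1"
proof (rule tendsto_sandwich)
  define q where "q = sqrt 2 / (3/2)"
  have "sqrt 2 < sqrt ((3/2)\<^sup>2)" by (intro real_sqrt_less_mono) (simp add: power2_eq_square)
  then have "0 \<le> q" "q < 1" by (simp_all add: q_def)
  then have "(\<lambda>n. q ^ n) \<longlonglongrightarrow> 0" by (intro LIMSEQ_power_zero) simp
  then show "(\<lambda>n. 1 - 4 * q ^ n) \<longlonglongrightarrow> 1"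
    using tendsto_diff[OF tendsto_const tendsto_mult_right_zero] by fastforce
  show "\<forall>\<^sub>F n in sequentially.
      1 - 4 * q ^ n \<le> real (card (odd_diff_sets n)) / real (card (parity_sets n))"
  proof (intro always_eventually allI)
    fix n
    define a where "a = real (card (odd_diff_sets n))"
    define b where "b = real (card (even_diff_sets n))"
    define p where "p = real (card (parity_sets n))"
    have a: "(3/2) ^ n \<le> a" unfolding a_def by (rule card_odd_diff_sets_ge)
    have "a > 0" by (rule less_le_trans[OF _ a]) simp
    have "a \<le> p" unfolding a_def p_def
      by (intro of_nat_mono card_mono finite_parity_sets) (simp add: parity_sets_eq)
    have "p \<le> a + b"
      using card_Un_le[of "odd_diff_sets n" "even_diff_sets n"]
      by (simp add: a_def b_def p_def parity_sets_eq)
    have "b \<le> 4 * q ^ n * (3/2) ^ n"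
      using card_even_diff_sets_le[of n] by (simp add: b_def q_def power_divide)
    also have "\<dots> \<le> 4 * q ^ n * p"
      using a \<open>a \<le> p\<close> \<open>0 \<le> q\<close> by (intro mult_left_mono) auto
    finally have "(1 - 4 * q ^ n) * p \<le> a" using \<open>p \<le> a + b\<close> by (simp add: algebra_simps)
    then show "1 - 4 * q ^ n \<le> real (card (odd_diff_sets n)) / real (card (parity_sets n))"
      using \<open>a > 0\<close> \<open>a \<le> p\<close> unfolding a_def[symmetric] p_def[symmetric]
      by (simp add: pos_le_divide_eq)
  qed
  show "\<forall>\<^sub>F n in sequentially. real (card (odd_diff_sets n)) / real (card (parity_sets n)) \<le> 1"
  proof (intro always_eventually allI)
    fix n
    have "card (odd_diff_sets n) \<le> card (parity_sets n)"
      by (intro card_mono finite_parity_sets) (simp add: parity_sets_eq)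
    then show "real (card (odd_diff_sets n)) / real (card (parity_sets n)) \<le> 1"
      by (intro divide_le_eq_1[THEN iffD2]) linarith
  qed
qed simp

end
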